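(* For every finite unichain MDP $\langle \mathcal S,\mathcal A,\mathcal P,\bm r\rangle$ and every $\beta\ge 0$, the iterative algorithm described in the context has worst-case computational complexity of $2|\mathcal D|+1$ times of solving a problem $\mathcal M(y)$; that is, it terminates after solving at most $2|\mathcal D|+1$ problems of the form $\mathcal M(y)$ (one per iteration).
   Context: MDP setting. $\mathcal S=\{1,\dots,S\}$ is a finite state space, $\mathcal A$ is a finite nonempty action space, $p(j|i,a)$ is the probability of moving from state $i$ to state $j$ under action $a$, and $r(i,a)\in\mathbb R$ is the reward. $\mathcal D$ is the (finite) set of stationary deterministic policies $d:\mathcal S\to\mathcal A$, and $|\mathcal D|$ is its cardinality. For $d\in\mathcal D$, $\bm P^d$ is the $S\times S$ transition matrix with entries $p(j|i,d(i))$. Standing assumption: for every $d\in\mathcal D$ the Markov chain with matrix $\bm P^d$ is a unichain (a single recurrent class plus possibly transient states), so it has a unique stationary distribution $\bm\pi^d=(\pi^d(i))_{i\in\mathcal S}$, with $\bm\pi^d\bm P^d=\bm\pi^d$ and $\sum_i\pi^d(i)=1$. Long-run mean: $\mu^d=\sum_{i\in\mathcal S}\pi^d(i)\,r(i,d(i))$. Long-run (steady-state) variance: $\sigma^d=\sum_{i\in\mathcal S}\pi^d(i)\,(r(i,d(i))-\mu^d)^2$ (note that $\sigma^d$ denotes the variance itself). Pseudo variance with pseudo mean $y\in\mathbb R$: $\tilde\sigma^d(y)=\sum_{i\in\mathcal S}\pi^d(i)\,(r(i,d(i))-y)^2$. For fixed $y$, $\mathcal M(y)$ denotes the problem $\min_{d\in\mathcal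 D}\{\beta\tilde\sigma^d(y)-\mu^d\}$. Put $\underline r=\min_{i,a}r(i,a)$ and $\overline r=\max_{i,a}r(i,a)$. Algorithm. Initialize $\mathbb Y=[\underline r,\overline r]$, $l=0$, and $\eta_{\rm out}=+\infty$. While $\mathbb Y\neq\varnothing$, perform one iteration: 1. Write $\mathbb Y$ as the disjoint union of its maximal intervals (connected components, possibly single points), sorted in descending order along the real line as $\mathbb Y_1,\mathbb Y_2,\dots$, and set $y_l=(\sup\mathbb Y_1+\inf\mathbb Y_1)/2$. 2. Solve $\mathcal M(y_l)$, obtaining some optimal policy $\tilde d_l\in\mathcal D$ of $\mathcal M(y_l)$ (any optimal policy may be returned). 3. Replace $\mathbb Y$ by $\mathbb Y\setminus\big[\,y_l-|y_l-\mu^{\tilde d_l}|,\ y_l+|y_l-\mu^{\tilde d_l}|\,\big]$. 4. If $\eta_{\rm out}>\beta\sigma^{\tilde d_l}-\mu^{\tilde d_l}$, set $\eta_{\rm out}=\beta\sigma^{\tilde d_l}-\mu^{\tilde d_l}$ and $d_{\rm out}=\tilde d_l$. 5. Set $l:=l+1$. When $\mathbb Y=\varnothing$, return $d_{\rm out}$ and $\eta_{\rm out}$. *)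

theory Defs
  imports "HOL-Probability.Probability"
begin

text \<open>\<open>first_passage P j n i\<close> is the probability that the chain started in \<open>i\<close> visits \<open>j\<close> for the
  first time at step \<open>n + 1\<close>; the initial position does not count as a visit.\<close>

primrec first_passage :: "real^'s^'s \<Rightarrow> 's \<Rightarrow> nat \<Rightarrow> 's::finite \<Rightarrow> real" where
  "first_passage P j 0 i = P $ i $ j"
| "first_passage P j (Suc n) i = (\<Sum>k\<in>UNIV - {j}. P $ i $ k * first_passage P j n k)"

definition recurrent :: "real^'s^'s \<Rightarrow> 's::finite \<Rightarrow> bool" where
  "recurrent P i \<longleftrightarrow> (\<lambda>n. first_passage P i n i) sums 1"

definition accessible :: "real^'s^'s \<Rightarrow> ('s::finite \<times> 's) set" where
  "accessible P = {(i, j). P $ i $ j > 0}\<^sup>*"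

definition communicating :: "real^'s^'s \<Rightarrow> ('s::finite \<times> 's) set" where
  "communicating P = accessible P \<inter> (accessible P)\<inverse>"

definition recurrent_class :: "real^'s^'s \<Rightarrow> 's::finite set \<Rightarrow> bool" where
  "recurrent_class P C \<longleftrightarrow> C \<in> UNIV // communicating P \<and> (\<forall>i\<in>C. recurrent P i)"

definition unichain :: "real^'s^'s::finite \<Rightarrow> bool" where
  "unichain P \<longleftrightarrow> (\<exists>!C. recurrent_class P C)"

definition stationary_distribution :: "real^'s^'s \<Rightarrow> real^'s::finite \<Rightarrow> bool" where
  "stationary_distribution P \<pi> \<longleftrightarrow>
     \<pi> v* P = \<pi> \<and> (\<forall>i. \<pi> $ i \<ge> 0) \<and> (\<Sum>i\<in>UNIV. \<pi> $ i) = 1"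

text \<open>States and actions are the elements of finite types. The kernel gives the law \<open>p i a\<close> of the
  next state, so \<open>pmf (p i a) j\<close> is $p(j \mid i, a)$. The stationary deterministic policies are
  all functions \<open>'s \<Rightarrow> 'a\<close>.\<close>

type_synonym ('s, 'a) kernel = "'s \<Rightarrow> 'a \<Rightarrow> 's pmf"
type_synonym ('s, 'a) reward = "'s \<Rightarrow> 'a \<Rightarrow> real"
type_synonym ('s, 'a) policy = "'s \<Rightarrow> 'a"

definition transition_matrix ::
    "('s, 'a) kernel \<Rightarrow> ('s, 'a) policy \<Rightarrow> real^'s^'s::finite" where
  "transition_matrix p d = (\<chi> i j. pmf (p i (d i)) j)"

definition unichain_mdp :: "('s::finite, 'a::finite) kernel \<Rightarrow> bool" where
  "unichain_mdp p \<longleftrightarrow> (\<forall>d. unichain (transition_matrix p d))"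

definition stationary :: "('s, 'a) kernel \<Rightarrow> ('s, 'a) policy \<Rightarrow> real^'s::finite" where
  "stationary p d = (THE \<pi>. stationary_distribution (transition_matrix p d) \<pi>)"

definition long_run_mean ::
    "('s::finite, 'a) kernel \<Rightarrow> ('s, 'a) reward \<Rightarrow> ('s, 'a) policy \<Rightarrow> real" where
  "long_run_mean p r d = (\<Sum>i\<in>UNIV. stationary p d $ i * r i (d i))"

definition pseudo_variance ::
    "('s::finite, 'a) kernel \<Rightarrow> ('s, 'a) reward \<Rightarrow> real \<Rightarrow> ('s, 'a) policy \<Rightarrow> real" where
  "pseudo_variance p r y d = (\<Sum>i\<in>UNIV. stationary p d $ i * (r i (d i) - y)\<^sup>2)"

definition long_run_variance ::
    "('s::finite, 'a) kernel \<Rightarrow> ('s, 'a) reward \<Rightarrow> ('s, 'a) policy \<Rightarrow> real" where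
  "long_run_variance p r d =
     (\<Sum>i\<in>UNIV. stationary p d $ i * (r i (d i) - long_run_mean p r d)\<^sup>2)"

definition mean_variance ::
    "('s::finite, 'a) kernel \<Rightarrow> ('s, 'a) reward \<Rightarrow> real \<Rightarrow> ('s, 'a) policy \<Rightarrow> real" where
  "mean_variance p r \<beta> d = \<beta> * long_run_variance p r d - long_run_mean p r d"

definition solves_pseudo_problem ::
    "('s::finite, 'a) kernel \<Rightarrow> ('s, 'a) reward \<Rightarrow> real \<Rightarrow> real \<Rightarrow> ('s, 'a) policy \<Rightarrow> bool" where
  "solves_pseudo_problem p r \<beta> y d \<longleftrightarrow>
     is_arg_min (\<lambda>d. \<beta> * pseudo_variance p r y d - long_run_mean p r d) (\<lambda>d. d \<in> UNIV) d"

record ('s, 'a) alg_state =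
  search_set :: "real set"
  counter :: nat
  best_value :: ereal
  best_policy :: "('s, 'a) policy option"

definition initial_state :: "('s::finite, 'a::finite) reward \<Rightarrow> ('s, 'a) alg_state" where
  "initial_state r =
     \<lparr>search_set = {Min (range (\<lambda>(i, a). r i a)) .. Max (range (\<lambda>(i, a). r i a))},
      counter = 0, best_value = \<infinity>, best_policy = None\<rparr>"

definition rightmost_component :: "real set \<Rightarrow> real set \<Rightarrow> bool" where
  "rightmost_component Y C \<longleftrightarrow>
     C \<in> components Y \<and> (\<forall>C'\<in>components Y. C' \<noteq> C \<longrightarrow> (\<forall>x'\<in>C'. \<forall>x\<in>C. x' < x))"

definition midpoint_of :: "real set \<Rightarrow> real" where
  "midpoint_of C = (Sup C + Inf C) / 2"

definition update_state ::
    "('s::finite, 'a) kernel \<Rightarrow> ('s, 'a) reward \<Rightarrow> real \<Rightarrow> real \<Rightarrow> ('s, 'a) policy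
      \<Rightarrow> ('s, 'a) alg_state \<Rightarrow> ('s, 'a) alg_state" where
  "update_state p r \<beta> y d s =
     (let \<rho> = \<bar>y - long_run_mean p r d\<bar>;
          \<eta> = ereal (mean_variance p r \<beta> d);
          better = best_value s > \<eta>
      in \<lparr>search_set = search_set s - {y - \<rho> .. y + \<rho>},
          counter = Suc (counter s),
          best_value = (if better then \<eta> else best_value s),
          best_policy = (if better then Some d else best_policy s)\<rparr>)"

text \<open>One pass through the loop body, solving exactly one pseudo problem. The relation is
  nondeterministic because any solution of that problem may be returned.\<close>

inductive iteration ::
    "('s::finite, 'a) kernel \<Rightarrow> ('s, 'a) reward \<Rightarrow> real
      \<Rightarrow> ('s, 'a) alg_state \<Rightarrow> ('s, 'a) alg_state \<Rightarrow> bool"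
  for p r \<beta> where
  "\<lbrakk>search_set s \<noteq> {}; rightmost_component (search_set s) C;
    solves_pseudo_problem p r \<beta> (midpoint_of C) d\<rbrakk>
   \<Longrightarrow> iteration p r \<beta> s (update_state p r \<beta> (midpoint_of C) d s)"

end

theory Submission
  imports Defs
begin

text \<open>The bound is a counting argument on the search set \<open>Y\<close>. One pass takes the midpoint \<open>y\<close> of an
  interval component \<open>C\<close> and deletes the closed interval of radius \<open>\<rho> = \<bar>y - \<mu>\<bar>\<close> around \<open>y\<close>, where
  \<open>\<mu>\<close> is the mean of the returned policy. Because the deletion is centred in \<open>C\<close>, only two things can
  happen. If \<open>\<rho>\<close> is at least half the length of \<open>C\<close>, then \<open>C\<close> disappears. Otherwise \<open>C\<close> is split in
  two; but \<open>\<mu>\<close> is an endpoint of the deleted interval, so it lay strictly inside \<open>C\<close>, and it has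
  now left \<open>Y\<close> for good. Components other than \<open>C\<close> lie on one side of \<open>y\<close> and are therefore only
  shortened, never split.

  Hence the potential consisting of the number of components of \<open>Y\<close> plus twice the number of
  policies whose mean lies in \<open>Y\<close> drops in every pass: a disappearance lowers the first term,
  while a split raises it by one and lowers the second by at least two. The potential is at most
  \<open>1 + 2\<bar>D\<bar>\<close> for the initial interval, where \<open>D\<close> is the set of policies, so there are at most that
  many passes.

  A pass is always possible while \<open>Y\<close> is nonempty: \<open>Y\<close> keeps finitely many components, so one of
  them is rightmost, and a minimum over finitely many policies is attained.\<close>

section \<open>Counting components\<close>

text \<open>Every component contains a whole piece of the cover, and distinct components contain distinct
  nonempty pieces.\<close>

lemma card_components_connected_cover:
  assumes "finite F" and conn: "\<And>A. A \<in> F \<Longrightarrow> connected A" and cover: "X = \<Union>F"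
  shows "finite (components X) \<and> card (components X) \<le> card (F - {{}})"
proof -
  have "\<exists>A \<in> F - {{}}. A \<subseteq> K" if K: "K \<in> components X" for K
  proof -
    from in_components_nonempty[OF K] obtain x where x: "x \<in> K" by blast
    with in_components_subset[OF K] cover obtain A where A: "A \<in> F" "x \<in> A" by blast
    have "A \<subseteq> K"
      using components_maximal[OF K conn[OF A(1)]] A x cover by blast
    with A show ?thesis by blast
  qed
  then obtain g where g: "\<And>K. K \<in> components X \<Longrightarrow> g K \<in> F - {{}} \<and> g K \<subseteq> K" by metis
  have inj: "inj_on g (components X)"
  proof (rule inj_onI)
    fix K L assume K: "K \<in> components X" and L: "L \<in> components X" and eq: "g K = g L"
    have "K \<inter> L \<noteq> {}" using g[OF K] g[OF L] eq by blast
    then show "K = L" using components_nonoverlap[OF K L] by blast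
  qed
  have img: "g ` components X \<subseteq> F - {{}}" using g by blast
  have fin: "finite (F - {{}})" using \<open>finite F\<close> by simp
  show ?thesis
    using inj_on_finite[OF inj img fin] card_inj_on_le[OF inj img fin] by blast
qed

section \<open>Deleting an interval centred in a component\<close>

text \<open>Only the two end points of a component are in doubt, since the deletions make components
  half open or open; working with strict inequalities avoids distinguishing these kinds.\<close>

lemma connected_between_Inf_Sup:
  fixes C :: "real set"
  assumes "connected C" "bounded C" "C \<noteq> {}" "Inf C < x" "x < Sup C"
  shows "x \<in> C"
proof -
  have bdd: "bdd_below C" "bdd_above C"
    using \<open>bounded C\<close> by (auto dest: bounded_imp_bdd_below bounded_imp_bdd_above)
  obtain a where "a \<in> C" "a < x"
    using assms(3,4) bdd by (auto simp: cInf_less_iff)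
  moreover obtain b where "b \<in> C" "x < b"
    using assms(3,5) bdd by (auto simp: less_cSup_iff)
  ultimately show ?thesis
    using connectedD_interval[OF \<open>connected C\<close>, of a b x] by simp
qed

lemma midpoint_of_mem:
  assumes "connected C" "bounded C" "C \<noteq> {}"
  shows "midpoint_of C \<in> C"
proof -
  have bdd: "bdd_below C" "bdd_above C"
    using \<open>bounded C\<close> by (auto dest: bounded_imp_bdd_below bounded_imp_bdd_above)
  obtain x where x: "x \<in> C" using assms(3) by blast
  then have le: "Inf C \<le> x" "x \<le> Sup C"
    using bdd by (auto intro: cInf_lower cSup_upper)
  show ?thesis
  proof (cases "Inf C = Sup C")
    case True
    with le have "midpoint_of C = x" by (simp add: midpoint_of_def)
    with x show ?thesis by simp
  next
    case False
    with le have "Inf C < midpoint_of C" "midpoint_of C < Sup C"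
      by (auto simp: midpoint_of_def)
    then show ?thesis using connected_between_Inf_Sup[OF assms] by blast
  qed
qed

text \<open>The deleted interval contains \<open>y\<close>, whereas \<open>C\<close> lies entirely on one side of \<open>y\<close>; so the
  deletion can only trim \<open>C\<close> at one end.\<close>

lemma connected_minus_interval_around_nonmember:
  fixes C :: "real set"
  assumes C: "connected C" and y: "y \<notin> C" and "\<rho> \<ge> 0"
  shows "connected (C - {y - \<rho> .. y + \<rho>})"
proof -
  have side: "x < y \<longleftrightarrow> z < y" if "x \<in> C" "z \<in> C" for x z
    using connectedD_interval[OF C that, of y] connectedD_interval[OF C that(2,1), of y] y
    by linarith
  have ne: "x \<noteq> y" if "x \<in> C" for x
    using that y by blast
  show ?thesis
  proof (cases "\<exists>z\<in>C. z < y")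
    case True
    then have "x < y" if "x \<in> C" for x using side that by blast
    then have "C - {y - \<rho> .. y + \<rho>} = C \<inter> {..<y - \<rho>}"
      using \<open>\<rho> \<ge> 0\<close> by (intro set_eqI) (simp, smt (verit))
    then show ?thesis
      using C by (simp add: is_interval_connected_1[symmetric] is_interval_Int)
  next
    case False
    then have "y < x" if "x \<in> C" for x using ne[OF that] that by (meson linorder_neqE)
    then have "C - {y - \<rho> .. y + \<rho>} = C \<inter> {y + \<rho> <..}"
      using \<open>\<rho> \<ge> 0\<close> by (intro set_eqI) (simp, smt (verit))
    then show ?thesis
      using C by (simp add: is_interval_connected_1[symmetric] is_interval_Int)
  qed
qed

text \<open>The two outcomes of a centred deletion: either \<open>C\<close> vanishes and the component count drops,
  or \<open>C\<close> is cut into two pieces and the endpoints of the deleted interval belonged to \<open>C\<close>.\<close>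

lemma components_minus_centred_interval:
  fixes Y :: "real set"
  assumes fin: "finite (components Y)" and bdd: "bounded Y"
    and C: "C \<in> components Y" and "\<rho> \<ge> 0"
  defines "y \<equiv> midpoint_of C"
  defines "J \<equiv> {y - \<rho> .. y + \<rho>}"
  shows "finite (components (Y - J))"
    and "card (components (Y - J)) < card (components Y)
       \<or> y - \<rho> \<in> C \<and> y + \<rho> \<in> C \<and> card (components (Y - J)) \<le> card (components Y) + 1"
proof -
  have conn: "connected C" and ne: "C \<noteq> {}" and sub: "C \<subseteq> Y"
    using C in_components_connected in_components_nonempty in_components_subset by blast+
  have bC: "bounded C" using bounded_subset[OF bdd sub] .
  have yC: "y \<in> C" using midpoint_of_mem[OF conn bC ne] by (simp add: y_def)
  \<comment> \<open>The pieces left over: \<open>G\<close> from the other components, \<open>L\<close> and \<open>R\<close> from \<open>C\<close> itself.\<close>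
  define G where "G = (\<lambda>C'. C' - J) ` (components Y - {C})"
  define L where "L = C \<inter> {..<y - \<rho>}"
  define R where "R = C \<inter> {y + \<rho> <..}"
  have finG: "finite G" using fin by (simp add: G_def)
  have cardG: "card G + 1 \<le> card (components Y)"
  proof -
    have "card G \<le> card (components Y - {C})"
      unfolding G_def using fin by (simp add: card_image_le)
    moreover have "card (components Y) > 0" using C fin card_gt_0_iff by blast
    ultimately show ?thesis using C fin by (simp add: card_Diff_singleton)
  qed
  have connG: "connected A" if "A \<in> G" for A
  proof -
    from that obtain C' where C': "C' \<in> components Y" "C' \<noteq> C" and A: "A = C' - J"
      by (auto simp: G_def)
    have "y \<notin> C'" using components_nonoverlap[OF C'(1) C] C'(2) yC by blast
    then show ?thesis
      unfolding A J_def
      by (intro connected_minus_interval_around_nonmember in_components_connected[OF C'(1)] \<open>\<rho> \<ge> 0\<close>)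
  qed
  have connLR: "connected L" "connected R"
    using conn unfolding L_def R_def
    by (auto simp: is_interval_connected_1[symmetric] intro: is_interval_Int)
  have cover: "Y - J = \<Union>(insert L (insert R G))"
  proof -
    have "C - J = L \<union> R" by (auto simp: L_def R_def J_def)
    moreover have "Y - J = (C - J) \<union> \<Union>G"
    proof -
      have "Y = C \<union> \<Union>(components Y - {C})" using Union_components[of Y] C by blast
      then show ?thesis unfolding G_def by blast
    qed
    ultimately show ?thesis by auto
  qed
  have count: "finite (components (Y - J)) \<and>
      card (components (Y - J)) \<le> card (insert L (insert R G) - {{}})"
    using card_components_connected_cover[OF _ _ cover] finG connG connLR by auto
  then show "finite (components (Y - J))" by blast
  show "card (components (Y - J)) < card (components Y)
       \<or> y - \<rho> \<in> C \<and> y + \<rho> \<in> C \<and> card (components (Y - J)) \<le> card (components Y) + 1"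
  proof (cases "\<rho> < (Sup C - Inf C) / 2")
    case True
    then have "Inf C < y - \<rho>" "y - \<rho> < Sup C" "Inf C < y + \<rho>" "y + \<rho> < Sup C"
      using \<open>\<rho> \<ge> 0\<close> by (auto simp: y_def midpoint_of_def field_simps)
    then have "y - \<rho> \<in> C" "y + \<rho> \<in> C"
      using connected_between_Inf_Sup[OF conn bC ne] by auto
    moreover have "card (insert L (insert R G) - {{}}) \<le> card G + 2"
    proof -
      have "card (insert L (insert R G) - {{}}) \<le> card (insert L (insert R G))"
        using finG by (intro card_mono) auto
      also have "\<dots> \<le> card G + 2"
        using finG by (simp add: card_insert_if)
      finally show ?thesis .
    qed
    ultimately show ?thesis using count cardG by linarith
  next
    case False
    then have "y - \<rho> \<le> Inf C" "Sup C \<le> y + \<rho>"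
      by (auto simp: y_def midpoint_of_def field_simps)
    moreover have "Inf C \<le> x" "x \<le> Sup C" if "x \<in> C" for x
      using that bC by (auto intro!: cInf_lower cSup_upper
          dest: bounded_imp_bdd_below bounded_imp_bdd_above)
    ultimately have "L = {}" "R = {}" by (force simp: L_def R_def)+
    then have "card (insert L (insert R G) - {{}}) \<le> card G"
      using finG by (auto intro!: card_mono)
    then show ?thesis using count cardG by linarith
  qed
qed

section \<open>Every nonempty search set admits a pass\<close>

text \<open>Disjoint real intervals are ordered like any points chosen from them, so the component with the
  largest chosen point is rightmost.\<close>

lemma rightmost_component_exists:
  assumes "finite (components Y)" "Y \<noteq> {}"
  shows "\<exists>C. rightmost_component Y C"
proof -
  define g :: "real set \<Rightarrow> real" where "g = (\<lambda>C. SOME x. x \<in> C)"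
  have g: "g C \<in> C" if "C \<in> components Y" for C
    using in_components_nonempty[OF that] unfolding g_def by (simp add: some_in_eq)
  have "components Y \<noteq> {}" using \<open>Y \<noteq> {}\<close> by simp
  then have "Max (g ` components Y) \<in> g ` components Y"
    using assms(1) by (intro Max_in) auto
  then obtain C where C: "C \<in> components Y" and gC: "g C = Max (g ` components Y)" by auto
  have max: "g C' \<le> g C" if "C' \<in> components Y" for C'
    unfolding gC using assms(1) that by simp
  have "x' < x" if C': "C' \<in> components Y" "C' \<noteq> C" and x': "x' \<in> C'" and x: "x \<in> C" for C' x' x
  proof (rule ccontr)
    assume "\<not> x' < x"
    then have "x' \<in> C \<or> g C \<in> C'"
      using connectedD_interval[OF in_components_connected[OF C] x g[OF C], of x']
        connectedD_interval[OF in_components_connected[OF C'(1)] g[OF C'(1)] x', of "g C"]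
        max[OF C'(1)] by linarith
    then show False
      using components_nonoverlap[OF C C'(1)] C'(2) g[OF C] x' by blast
  qed
  then show ?thesis using C unfolding rightmost_component_def by blast
qed

lemma iteration_enabled:
  fixes p :: "('s::finite, 'a::finite) kernel"
  assumes "finite (components (search_set s))" "search_set s \<noteq> {}"
  shows "\<exists>s'. iteration p r \<beta> s s'"
proof -
  obtain C where C: "rightmost_component (search_set s) C"
    using rightmost_component_exists[OF assms] by blast
  obtain d where "solves_pseudo_problem p r \<beta> (midpoint_of C) d"
    unfolding solves_pseudo_problem_def
    using ex_is_arg_min_if_finite[of "UNIV :: ('s, 'a) policy set"] by auto
  with assms(2) C show ?thesis by (blast intro: iteration.intros)
qed

section \<open>The potential of the search set\<close>

lemma search_set_update_state:
  "search_set (update_state p r \<beta> y d s) =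
     search_set s - {y - \<bar>y - long_run_mean p r d\<bar> .. y + \<bar>y - long_run_mean p r d\<bar>}"
  by (simp add: update_state_def Let_def)

text \<open>The weight two makes up for a split, which creates one extra component, and still leaves a
  strict decrease.\<close>

definition potential ::
    "('s::finite, 'a::finite) kernel \<Rightarrow> ('s, 'a) reward \<Rightarrow> real set \<Rightarrow> nat" where
  "potential p r Y = card (components Y) + 2 * card {d. long_run_mean p r d \<in> Y}"

lemma iteration_decreases_potential:
  assumes it: "iteration p r \<beta> s s'"
    and fin: "finite (components (search_set s))" and bdd: "bounded (search_set s)"
  shows "finite (components (search_set s'))" "bounded (search_set s')"
    "potential p r (search_set s') < potential p r (search_set s)"
proof -
  from it obtain C d where C: "C \<in> components (search_set s)"
    and s': "s' = update_state p r \<beta> (midpoint_of C) d s"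
    by (elim iteration.cases) (simp add: rightmost_component_def, blast)
  define y where "y = midpoint_of C"
  define \<mu> where "\<mu> = long_run_mean p r d"
  define Y where "Y = search_set s"
  define Y' where "Y' = search_set s'"
  have Y': "Y' = Y - {y - \<bar>y - \<mu>\<bar> .. y + \<bar>y - \<mu>\<bar>}"
    by (simp add: Y'_def Y_def s' search_set_update_state y_def \<mu>_def)
  note cut = components_minus_centred_interval[OF fin bdd C abs_ge_zero[of "y - \<mu>"],
      folded y_def Y_def, folded Y']
  show "finite (components (search_set s'))" using cut(1) by (simp add: Y'_def)
  show "bounded (search_set s')"
    using bdd bounded_subset[of Y Y'] Y' by (auto simp: Y_def Y'_def)
  have sub: "{e. long_run_mean p r e \<in> Y'} \<subseteq> {e. long_run_mean p r e \<in> Y}"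
    using Y' by blast
  \<comment> \<open>In the split case \<open>\<mu>\<close>, an end point of the deleted interval, moves out of the search set.\<close>
  have "potential p r Y' < potential p r Y"
    using cut(2)
  proof (elim disjE conjE)
    assume "card (components Y') < card (components Y)"
    then show ?thesis
      using card_mono[OF _ sub] by (simp add: potential_def)
  next
    assume ends: "y - \<bar>y - \<mu>\<bar> \<in> C" "y + \<bar>y - \<mu>\<bar> \<in> C"
      and le: "card (components Y') \<le> card (components Y) + 1"
    have "\<mu> = y - \<bar>y - \<mu>\<bar> \<or> \<mu> = y + \<bar>y - \<mu>\<bar>" by linarith
    then have "\<mu> \<in> Y"
      using ends in_components_subset[OF C] by (auto simp: Y_def)
    moreover have "\<mu> \<notin> Y'"
      unfolding Y' by simp linarith
    ultimately have "{e. long_run_mean p r e \<in> Y'} \<subset> {e. long_run_mean p r e \<in> Y}"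
      using sub unfolding \<mu>_def by blast
    then have "card {e. long_run_mean p r e \<in> Y'} < card {e. long_run_mean p r e \<in> Y}"
      by (intro psubset_card_mono) auto
    then show ?thesis using le by (simp add: potential_def)
  qed
  then show "potential p r (search_set s') < potential p r (search_set s)"
    by (simp add: Y_def Y'_def)
qed

lemma iterations_bounded_by_potential:
  assumes "(iteration p r \<beta> ^^ n) s\<^sub>0 s"
    and "finite (components (search_set s\<^sub>0))" "bounded (search_set s\<^sub>0)"
  shows "finite (components (search_set s)) \<and> bounded (search_set s) \<and>
    n + potential p r (search_set s) \<le> potential p r (search_set s\<^sub>0)"
  using assms(1)
proof (induction n arbitrary: s)
  case 0
  then show ?case using assms(2,3) by simp
next
  case (Suc n)
  then obtain t where "(iteration p r \<beta> ^^ n) s\<^sub>0 t" and step: "iteration p r \<beta> t s"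
    by auto
  with Suc.IH have IH: "finite (components (search_set t))" "bounded (search_set t)"
    "n + potential p r (search_set t) \<le> potential p r (search_set s\<^sub>0)" by auto
  show ?case
    using iteration_decreases_potential[OF step IH(1,2)] IH(3) by auto
qed

lemma initial_components:
  "finite (components (search_set (initial_state r)))"
  "card (components (search_set (initial_state r))) \<le> 1"
  using card_components_connected_cover[of "{search_set (initial_state r)}"]
  by (auto simp: initial_state_def card_Diff_singleton_if split: if_splits)

theorem corollary1:
  fixes p :: "('s::finite, 'a::finite) kernel"
    and r :: "('s, 'a) reward"
    and \<beta> :: real
  assumes "unichain_mdp p"
    and "\<beta> \<ge> 0"
  shows "(\<forall>n s. (iteration p r \<beta> ^^ n) (initial_state r) s
              \<longrightarrow> n \<le> 2 * card (UNIV :: ('s, 'a) policy set) + 1)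
       \<and> (\<forall>n s. (iteration p r \<beta> ^^ n) (initial_state r) s \<and> search_set s \<noteq> {}
              \<longrightarrow> (\<exists>s'. iteration p r \<beta> s s'))"
proof -
  have bdd: "bounded (search_set (initial_state r))" by (simp add: initial_state_def)
  have "card {d. long_run_mean p r d \<in> search_set (initial_state r)}
      \<le> card (UNIV :: ('s, 'a) policy set)"
    by (intro card_mono) auto
  then have "potential p r (search_set (initial_state r)) \<le> 2 * card (UNIV :: ('s, 'a) policy set) + 1"
    using initial_components(2)[of r] unfolding potential_def by linarith
  then show ?thesis
    using iterations_bounded_by_potential[OF _ initial_components(1) bdd] iteration_enabled
    by (meson add_leD1 order_trans)
qed

end
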